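(* Let $n\geq 1$ and $0\leq j<2n-1$ be integers. Then the number of northeastern lattice paths from $(0,0)$ to $(n,n)$ enclosing an area congruent to $j$ modulo $2n-1$ is equal to $\frac{1}{2n-1}\binom{2n}{n}$, which in particular is independent of $j$.
   Context: A northeastern lattice path from $(0,0)$ to $(a,b)$ (with $a,b$ nonnegative integers) is a sequence of $a+b$ unit steps, each equal to $(1,0)$ (east) or $(0,1)$ (north), starting at $(0,0)$ and ending at $(a,b)$; so exactly $a$ steps are east and $b$ steps are north. The area enclosed by such a path is the area of the region of the rectangle $[0,a]\times[0,b]$ lying below (and to the right of) the path, i.e. the sum over all east steps of the $y$-coordinate at which the step is taken. Equivalently, it is the number of pairs consisting of a north step and a later east step. *)

theory Defs
  imports Complex_Main "HOL-Number_Theory.Cong"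
begin

datatype step = East | North

text \<open>A path starting at (0,0) is given by its list of steps; \<open>vertex p i\<close> is the lattice
  point reached after the first \<open>i\<close> of them.\<close>

definition vertex :: "step list \<Rightarrow> nat \<Rightarrow> nat \<times> nat" where
  "vertex p i = (count_list (take i p) East, count_list (take i p) North)"

definition lattice_paths :: "nat \<Rightarrow> nat \<Rightarrow> step list set" where
  "lattice_paths a b = {p. length p = a + b \<and> vertex p (length p) = (a, b)}"

text \<open>The area of the region below and to the right of the path: the unit column under the east
  step with index \<open>i\<close> (counting from 0) has height equal to the y-coordinate of \<open>vertex p i\<close>.\<close>

definition area :: "step list \<Rightarrow> nat" where
  "area p = (\<Sum>i | i < length p \<and> p ! i = East. snd (vertex p i))"

end

theory Submission
  imports Defs
begin

text \<open>Fix the last step of the path and rotate the other \<open>2 * n - 1\<close> steps cyclically.  On paths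
  to \<open>(a, b)\<close>, moving the first step to the end lowers the area by \<open>a\<close> if that step is north (it
  lay before all \<open>a\<close> east steps and now lies behind them) and raises it by \<open>b\<close> if it is east.
  These two changes agree modulo \<open>a + b\<close>, so rotation always shifts the area by \<open>- a\<close> modulo the
  number of steps (\<open>area_rotate1\<close>).  If \<open>a\<close> and \<open>a + b\<close> are coprime, iterating the rotation
  carries every residue class of the area injectively into every other one, so all classes are
  equally large (\<open>equidistributed_of_shift\<close>).

  The diagonal itself is not coprime, but removing the last step leaves a path to \<open>(n - 1, n)\<close> or
  to \<open>(n, n - 1)\<close>; both are coprime, both have \<open>2 * n - 1\<close> steps, and the removed step
  contributes the constant \<open>n\<close> or \<open>0\<close> to the area.  The two equidistributed families together
  have \<open>(2 * n - 1 choose n - 1) + (2 * n - 1 choose n) = (2 * n choose n)\<close> members.\<close>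

section \<open>Equidistribution from a shifting map\<close>

text \<open>Applying \<open>r\<close> \<open>k\<close> times maps the class of \<open>j + k * c\<close> injectively into the class of \<open>j\<close>.
  Since \<open>c\<close> is invertible modulo \<open>m\<close>, every residue has the form \<open>j + k * c\<close>, so each class is at
  most as large as each other class.\<close>

lemma equidistributed_of_shift:
  fixes f :: "'a \<Rightarrow> nat" and m c j :: nat
  assumes fin: "finite S" and m: "m > 0" and cop: "coprime c m"
    and maps: "r ` S \<subseteq> S" and inj: "inj_on r S"
    and shift: "\<And>x. x \<in> S \<Longrightarrow> [f (r x) + c = f x] (mod m)"
  shows "m * card {x \<in> S. [f x = j] (mod m)} = card S"
proof -
  define N where "N i = card {x \<in> S. [f x = i] (mod m)}" for i
  have step: "N (i + c) \<le> N i" for i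
    unfolding N_def
  proof (rule card_inj_on_le[where f = r])
    show "inj_on r {x \<in> S. [f x = i + c] (mod m)}"
      using inj by (rule inj_on_subset) auto
    show "r ` {x \<in> S. [f x = i + c] (mod m)} \<subseteq> {x \<in> S. [f x = i] (mod m)}"
    proof safe
      fix x assume x: "x \<in> S" "[f x = i + c] (mod m)"
      then show "r x \<in> S" using maps by auto
      have "[f (r x) + c = i + c] (mod m)" using shift[OF x(1)] x(2) by (rule cong_trans)
      then show "[f (r x) = i] (mod m)" by (simp only: cong_add_rcancel_nat)
    qed
    show "finite {x \<in> S. [f x = i] (mod m)}"
      using fin by simp
  qed
  have steps: "N (i + k * c) \<le> N i" for i k
  proof (induction k)
    case (Suc k)
    have "N (i + Suc k * c) \<le> N (i + k * c)"
      using step[of "i + k * c"] by (simp add: algebra_simps)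
    with Suc show ?case by simp
  qed simp
  have le: "N i \<le> N l" for i l
  proof -
    obtain d where d: "[c * d = 1] (mod m)"
      using cong_solve_coprime_nat[OF cop] by auto
    \<comment> \<open>\<open>(m - 1) * l\<close> stands for \<open>- l\<close>, so this number of steps is \<open>d * (i - l)\<close> modulo \<open>m\<close>.\<close>
    define k where "k = d * (i + (m - 1) * l)"
    have "[k * c = i + (m - 1) * l] (mod m)"
      using cong_scalar_right[OF d, of "i + (m - 1) * l"] by (simp add: k_def ac_simps)
    then have "[l + k * c = l + (i + (m - 1) * l)] (mod m)"
      by (simp add: cong_add_lcancel_nat)
    also have "l + (i + (m - 1) * l) = i + m * l"
      using m by (cases m) auto
    also have "[i + m * l = i] (mod m)"
      by (simp add: cong_def)
    finally have "N (l + k * c) = N i"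
      unfolding N_def by (metis (no_types, opaque_lifting) cong_def)
    with steps[of l k] show ?thesis by simp
  qed
  have "S = (\<Union>i<m. {x \<in> S. [f x = i] (mod m)})"
    using m by (auto simp: cong_def)
  then have "card S = card (\<Union>i<m. {x \<in> S. [f x = i] (mod m)})"
    by simp
  also have "\<dots> = (\<Sum>i<m. N i)"
    unfolding N_def using fin by (intro card_UN_disjoint) (auto simp: cong_def)
  also have "\<dots> = (\<Sum>i<m. N j)"
    using le by (intro sum.cong) (auto intro: antisym)
  finally show ?thesis by (simp add: N_def)
qed

section \<open>Lattice paths as words\<close>

lemma lattice_paths_iff_count:
  "p \<in> lattice_paths a b \<longleftrightarrow> count_list p East = a \<and> count_list p North = b"
proof -
  have "length p = count_list p East + count_list p North"
  proof (induction p)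
    case (Cons s p)
    then show ?case by (cases s) auto
  qed simp
  then show ?thesis by (auto simp: lattice_paths_def vertex_def)
qed

lemma finite_lattice_paths: "finite (lattice_paths a b)"
proof (rule finite_subset)
  show "lattice_paths a b \<subseteq> {p. set p \<subseteq> {East, North} \<and> length p = a + b}"
    using step.exhaust by (auto simp: lattice_paths_def)
  show "finite {p. set p \<subseteq> {East, North} \<and> length p = a + b}"
    by (rule finite_lists_length_eq) simp
qed

lemma lattice_paths_0_right: "lattice_paths a 0 = {replicate a East}"
proof -
  have "count_list p North = 0 \<Longrightarrow> p = replicate (count_list p East) East" for p
  proof (induction p)
    case (Cons s p)
    then show ?case by (cases s) auto
  qed simp
  moreover have "count_list (replicate a East) East = a" "count_list (replicate a East) North = 0"
    by (induction a) auto
  ultimately show ?thesis by (auto simp: lattice_paths_iff_count)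
qed

lemma lattice_paths_0_left: "lattice_paths 0 b = {replicate b North}"
proof -
  have "count_list p East = 0 \<Longrightarrow> p = replicate (count_list p North) North" for p
  proof (induction p)
    case (Cons s p)
    then show ?case by (cases s) auto
  qed simp
  moreover have "count_list (replicate b North) North = b" "count_list (replicate b North) East = 0"
    by (induction b) auto
  ultimately show ?thesis by (auto simp: lattice_paths_iff_count)
qed

lemma lattice_paths_Suc_Suc:
  "lattice_paths (Suc a) (Suc b) =
     (\<lambda>q. q @ [East]) ` lattice_paths a (Suc b) \<union> (\<lambda>q. q @ [North]) ` lattice_paths (Suc a) b"
proof -
  have "p \<in> (\<lambda>q. q @ [East]) ` lattice_paths a (Suc b) \<union> (\<lambda>q. q @ [North]) ` lattice_paths (Suc a) b"
    if "p \<in> lattice_paths (Suc a) (Suc b)" for p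
  proof (cases p rule: rev_cases)
    case (snoc q s)
    with that show ?thesis by (cases s) (auto simp: lattice_paths_iff_count)
  qed (use that in \<open>auto simp: lattice_paths_iff_count\<close>)
  moreover have "q @ [East] \<in> lattice_paths (Suc a) (Suc b)" if "q \<in> lattice_paths a (Suc b)" for q
    using that by (simp add: lattice_paths_iff_count)
  moreover have "q @ [North] \<in> lattice_paths (Suc a) (Suc b)" if "q \<in> lattice_paths (Suc a) b" for q
    using that by (simp add: lattice_paths_iff_count)
  ultimately show ?thesis by blast
qed

lemma card_lattice_paths_Suc_Suc:
  "card {p \<in> lattice_paths (Suc a) (Suc b). P p} =
     card {q \<in> lattice_paths a (Suc b). P (q @ [East])} +
     card {q \<in> lattice_paths (Suc a) b. P (q @ [North])}"
proof -
  let ?E = "{q \<in> lattice_paths a (Suc b). P (q @ [East])}"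
  let ?N = "{q \<in> lattice_paths (Suc a) b. P (q @ [North])}"
  have split: "{p \<in> lattice_paths (Suc a) (Suc b). P p}
      = (\<lambda>q. q @ [East]) ` ?E \<union> (\<lambda>q. q @ [North]) ` ?N"
    unfolding lattice_paths_Suc_Suc by blast
  have "inj (\<lambda>q. q @ [s])" for s :: step
    by (rule injI) simp
  then have images: "card ((\<lambda>q. q @ [s]) ` A) = card A" for s :: step and A
    by (metis card_image inj_on_subset subset_UNIV)
  have "card ((\<lambda>q. q @ [East]) ` ?E \<union> (\<lambda>q. q @ [North]) ` ?N)
      = card ((\<lambda>q. q @ [East]) ` ?E) + card ((\<lambda>q. q @ [North]) ` ?N)"
    by (rule card_Un_disjoint) (auto simp: finite_lattice_paths)
  then show ?thesis unfolding split images .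
qed

lemma card_lattice_paths: "card (lattice_paths a b) = (a + b) choose a"
proof (induction "a + b" arbitrary: a b)
  case 0
  then show ?case by (simp add: lattice_paths_0_right)
next
  case (Suc k)
  show ?case
  proof (cases "a = 0 \<or> b = 0")
    case True
    then show ?thesis by (auto simp: lattice_paths_0_right lattice_paths_0_left)
  next
    case False
    then obtain a' b' where ab: "a = Suc a'" "b = Suc b'"
      by (metis not0_implies_Suc)
    then show ?thesis
      using card_lattice_paths_Suc_Suc[of a' b' "\<lambda>_. True"] Suc.hyps(1)[of a' b] Suc.hyps(1)[of a b']
        Suc.hyps(2)
      by simp
  qed
qed

section \<open>Area under rotation\<close>

lemma area_snoc: "area (p @ [s]) = area p + (if s = East then count_list p North else 0)"
proof -
  have "{i. i < length (p @ [s]) \<and> (p @ [s]) ! i = East} =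
      {i. i < length p \<and> p ! i = East} \<union> (if s = East then {length p} else {})"
    by (auto simp: nth_append less_Suc_eq)
  then show ?thesis
    by (simp add: area_def vertex_def)
qed

text \<open>The area counts pairs of a north step and a later east step, so a leading north step adds
  the number of east steps.\<close>

lemma area_Cons: "area (s # p) = area p + (if s = North then count_list p East else 0)"
proof (induction p rule: rev_induct)
  case Nil
  show ?case using area_snoc[of "[]" s] by (simp add: area_def)
next
  case (snoc x p)
  then show ?case
    using area_snoc[of "s # p" x] by (cases s; cases x) (auto simp: area_snoc)
qed

lemma area_rotate1:
  assumes "p \<in> lattice_paths a b" "p \<noteq> []"
  shows "[area (rotate1 p) + a = area p] (mod (a + b))"
proof -
  obtain s q where p: "p = s # q" using assms(2) by (cases p) auto
  show ?thesis
  proof (cases s)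
    case East
    then have "area (rotate1 p) + a = area p + (a + b)"
      using assms(1) by (auto simp: p area_Cons area_snoc lattice_paths_iff_count)
    then show ?thesis unfolding cong_def by (metis mod_add_self2)
  next
    case North
    then have "area (rotate1 p) + a = area p"
      using assms(1) by (auto simp: p area_Cons area_snoc lattice_paths_iff_count)
    then show ?thesis by simp
  qed
qed

text \<open>The constant \<open>d\<close> leaves room for the area that a fixed last step adds to the path.\<close>

lemma area_equidistributed:
  assumes "coprime a (a + b)" "a + b > 0"
  shows "(a + b) * card {p \<in> lattice_paths a b. [area p + d = j] (mod (a + b))} = (a + b) choose a"
proof -
  have "(a + b) * card {p \<in> lattice_paths a b. [area p + d = j] (mod (a + b))}
      = card (lattice_paths a b)"
  proof (rule equidistributed_of_shift[where r = rotate1 and c = a])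
    show "rotate1 ` lattice_paths a b \<subseteq> lattice_paths a b"
    proof safe
      fix p assume "p \<in> lattice_paths a b"
      then show "rotate1 p \<in> lattice_paths a b"
        by (cases p) (auto simp: lattice_paths_iff_count)
    qed
    show "inj_on rotate1 (lattice_paths a b)"
      by (rule inj_on_subset[OF inj_rotate1]) simp
    show "[area (rotate1 p) + d + a = area p + d] (mod (a + b))" if "p \<in> lattice_paths a b" for p
    proof -
      have "p \<noteq> []" using that assms(2) by (auto simp: lattice_paths_def)
      from cong_add[OF area_rotate1[OF that this] cong_refl[of d]]
      show ?thesis by (simp add: ac_simps)
    qed
  qed (use assms finite_lattice_paths in auto)
  then show ?thesis by (simp add: card_lattice_paths)
qed

theorem theorem1:
  fixes n j :: nat
  assumes "n \<ge> 1" and "j < 2 * n - 1"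
  shows "real (card {p \<in> lattice_paths n n. [area p = j] (mod (2 * n - 1))})
           = 1 / (2 * real n - 1) * real ((2 * n) choose n)"
proof -
  obtain k where n: "n = Suc k" using assms(1) by (cases n) auto
  define m where "m = 2 * n - 1"
  have m: "m = k + Suc k" "m = Suc k + k" by (auto simp: m_def n)
  have cop_E: "coprime k (k + Suc k)" and cop_N: "coprime (Suc k) (Suc k + k)"
    by (simp_all only: coprime_iff_gcd_eq_1 gcd_add2)
      (simp_all only: flip: coprime_iff_gcd_eq_1, simp_all)
  let ?P = "\<lambda>p. [area p = j] (mod m)"
  \<comment> \<open>A final east step runs at height \<open>n\<close>.\<close>
  have "{q \<in> lattice_paths k (Suc k). ?P (q @ [East])} =
      {q \<in> lattice_paths k (Suc k). [area q + n = j] (mod m)}"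
    by (auto simp: area_snoc lattice_paths_iff_count n)
  then have E: "m * card {q \<in> lattice_paths k (Suc k). ?P (q @ [East])} = m choose k"
    using area_equidistributed[OF cop_E, of n j] by (simp add: m(1))
  have N: "m * card {q \<in> lattice_paths (Suc k) k. ?P (q @ [North])} = m choose Suc k"
    using area_equidistributed[OF cop_N, of 0 j] by (simp add: area_snoc m(2))
  have "m * card {p \<in> lattice_paths n n. ?P p} = (m choose k) + (m choose Suc k)"
    using E N by (simp add: n card_lattice_paths_Suc_Suc distrib_left)
  also have "\<dots> = Suc m choose Suc k" by simp
  also have "\<dots> = (2 * n) choose n" by (simp add: m_def n)
  finally have "real m * real (card {p \<in> lattice_paths n n. ?P p}) = real ((2 * n) choose n)"
    by (metis of_nat_mult)
  moreover have "real m = 2 * real n - 1" using n by (simp add: m_def)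
  ultimately show ?thesis
    using n by (simp add: m_def field_simps)
qed

end
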